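(* Let $m\ge 3$ and let $(X,\mathcal B)$ be a CURD (with $\lambda=1$) on $n$ varieties with partition $m^1 2^{\left(\frac{n-m}{2}\right)}$, where $w$ is the number of parallel classes and each variety is in exactly $t$ blocks of size $m$. Then $mw=tn$.
   Context: Let $X$ be a finite set of $n$ elements called varieties (or students). A block is a subset of $X$. A pairwise balanced design with index $\lambda$ is a pair $(X,\mathcal B)$, where $\mathcal B$ is a collection of blocks such that each pair of distinct varieties appears together in exactly $\lambda$ blocks. It is resolvable if $\mathcal B$ can be partitioned into sets, called parallel classes (or weeks), each of which contains each variety exactly once (i.e. the blocks of each parallel class partition $X$). It is a Class-Uniformly Resolvable Design (CURD) if moreover every parallel class has the same block sizes (with multiplicity). A CURD comes with this partition into parallel classes. A CURD on $n$ varieties has partition $m^1 2^{\left(\frac{n-m}{2}\right)}$ if each parallel class consists of exactly one block of size $m$ and exactly $\frac{n-m}{2}$ blocks of size $2$ (the case $n=m$, with no blocks of size 2, is allowed). Throughout, $\lambda=1$. *)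

theory Defs
  imports Main "HOL-Library.Multiset"
begin

text \<open>Collections of blocks are multisets, since for general index repeated blocks are allowed.\<close>

locale pairwise_balanced_design =
  fixes X :: "'a set" and \<B> :: "'a set multiset" and \<Lambda> :: nat
  assumes finite_varieties: "finite X"
    and block_subset: "b \<in># \<B> \<Longrightarrow> b \<subseteq> X"
    and balanced: "x \<in> X \<Longrightarrow> y \<in> X \<Longrightarrow> x \<noteq> y \<Longrightarrow> size {#b \<in># \<B>. x \<in> b \<and> y \<in> b#} = \<Lambda>"

text \<open>The resolution \<open>\<P>\<close> is a multiset of parallel classes, each a multiset of blocks, whose union
  with multiplicity is the whole block collection; the number of classes is \<open>size \<P>\<close>.\<close>

locale resolved_design = pairwise_balanced_design +
  fixes \<P> :: "'a set multiset multiset"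
  assumes resolution: "\<Sum>\<^sub># \<P> = \<B>"
    and parallel_class: "p \<in># \<P> \<Longrightarrow> x \<in> X \<Longrightarrow> size {#b \<in># p. x \<in> b#} = 1"

definition block_sizes :: "'a set multiset \<Rightarrow> nat multiset" where
  "block_sizes p = image_mset card p"

locale curd = resolved_design +
  assumes class_uniform: "p \<in># \<P> \<Longrightarrow> q \<in># \<P> \<Longrightarrow> block_sizes p = block_sizes q"

definition has_partition :: "'a set multiset multiset \<Rightarrow> nat multiset \<Rightarrow> bool" where
  "has_partition \<P> T \<longleftrightarrow> (\<forall>p \<in># \<P>. block_sizes p = T)"

text \<open>The type \<open>m\<^sup>1 2\<^bsup>(n-m)/2\<^esup>\<close>. Truncation is harmless: the block sizes of a parallel class on
  \<open>n\<close> varieties sum to \<open>n\<close>, so a class of this type exists only if \<open>m \<le> n\<close> and \<open>n - m\<close> is even.\<close>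

definition type_m_2 :: "nat \<Rightarrow> nat \<Rightarrow> nat multiset" where
  "type_m_2 n m = {#m#} + replicate_mset ((n - m) div 2) 2"

end

theory Submission
  imports Defs
begin

text \<open>Count the incidences between varieties and blocks of size \<open>m\<close> in two ways. Since \<open>m \<noteq> 2\<close>,
  each parallel class contains exactly one block of size \<open>m\<close>, so there are \<open>w\<close> such blocks.\<close>

text \<open>Double counting by induction on \<open>M\<close>: a new block \<open>b\<close> adds 1 to
  the summand of each of its points, hence \<open>card b\<close> in all, because no point of
  \<open>b\<close> lies outside \<open>X\<close>.\<close>

lemma sum_size_filter_mem_eq_sum_mset_card:
  assumes "finite X" "\<And>b. b \<in># M \<Longrightarrow> b \<subseteq> X"
  shows "(\<Sum>x\<in>X. size {#b \<in># M. x \<in> b#}) = (\<Sum>b\<in>#M. card b)"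
  using assms(2)
proof (induction M)
  case empty
  then show ?case by simp
next
  case (add b M)
  have "(\<Sum>x\<in>X. size {#c \<in># add_mset b M. x \<in> c#})
      = (\<Sum>x\<in>X. (if x \<in> b then 1 else 0) + size {#c \<in># M. x \<in> c#})"
    by (rule sum.cong) auto
  also have "\<dots> = card (X \<inter> b) + (\<Sum>c\<in>#M. card c)"
    using add \<open>finite X\<close> by (simp add: sum.distrib flip: sum.inter_restrict)
  also have "X \<inter> b = b"
    using add.prems by auto
  finally show ?case by simp
qed

text \<open>Carries a count made in each parallel class over to the whole design: filtering and size
  are additive over multiset union, so repetitions cause no trouble.\<close>

lemma size_filter_sum_mset:
  assumes "\<And>p. p \<in># P \<Longrightarrow> size (filter_mset Q p) = k"
  shows "size (filter_mset Q (\<Sum>\<^sub># P)) = k * size P"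
  using assms by (induction P) auto

lemma count_block_sizes: "count (block_sizes p) k = size {#b \<in># p. card b = k#}"
  unfolding block_sizes_def by (induction p) auto

theorem theorem2p3:
  fixes X :: "'a set" and \<B> :: "'a set multiset" and \<P> :: "'a set multiset multiset"
    and n m w t :: nat
  assumes "m \<ge> 3"
    and "curd X \<B> 1 \<P>"
    and "card X = n"
    and "has_partition \<P> (type_m_2 n m)"
    and "w = size \<P>"
    and "\<And>x. x \<in> X \<Longrightarrow> size {#b \<in># \<B>. x \<in> b \<and> card b = m#} = t"
  shows "m * w = t * n"
proof -
  interpret curd X \<B> 1 \<P> by fact
  let ?M = "{#b \<in># \<B>. card b = m#}"
  have "size {#b \<in># p. card b = m#} = 1" if "p \<in># \<P>" for p
    using that assms(1,4) by (simp add: has_partition_def type_m_2_def flip: count_block_sizes)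
  then have "size ?M = w"
    using size_filter_sum_mset[of \<P> "\<lambda>b. card b = m" 1] assms(5) resolution by simp
  moreover have "(\<Sum>b\<in>#?M. card b) = (\<Sum>b\<in>#?M. m)"
    by (rule arg_cong[where f = sum_mset], rule image_mset_cong) simp
  \<comment> \<open>The link between the two counts: the right side is \<open>m * w\<close> by the
    facts above, the left side is evaluated per variety below.\<close>
  moreover have "(\<Sum>x\<in>X. size {#b \<in># ?M. x \<in> b#}) = (\<Sum>b\<in>#?M. card b)"
    by (rule sum_size_filter_mem_eq_sum_mset_card) (auto simp: finite_varieties dest: block_subset)
  moreover have "(\<Sum>x\<in>X. size {#b \<in># ?M. x \<in> b#}) = t * n"
    using assms(3,6) by (simp add: filter_filter_mset conj_commute)
  ultimately show ?thesis
    by (simp add: mult.commute)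
qed

end
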